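(* The range of every $\mathbb{BC}$-univalent, $\mathbb{BC}$-holomorphic function $F:\mathbb{D}_{\mathbb{BC}}\to\mathbb{BC}$ from the bicomplex unit disk $\mathbb{D}_{\mathbb{BC}}$ onto a subset of the bicomplex plane contains the bicomplex disk $\mathbb{D}(0,\tfrac14)$.
   Context: Bicomplex numbers: $\mathbb{BC}=\{Z_1+\mathbf{j}Z_2: Z_1,Z_2\in\mathbb{C}(\mathbf{i})\}$, where $\mathbf{i}\neq\mathbf{j}$, $\mathbf{i}\mathbf{j}=\mathbf{j}\mathbf{i}=\mathbf{k}$, $\mathbf{i}^2=\mathbf{j}^2=-1$, and $\mathbb{C}(\mathbf{i})$ is the complex field with imaginary unit $\mathbf{i}$. Put $\mathbf{e_1}=\frac12(1+\mathbf{k})$, $\mathbf{e_2}=\frac12(1-\mathbf{k})$; these satisfy $\mathbf{e_1}+\mathbf{e_2}=1$, $\mathbf{e_1}\mathbf{e_2}=0$, $\mathbf{e_l}^2=\mathbf{e_l}$ for $l=1,2$. Every $Z=Z_1+\mathbf{j}Z_2$ is written uniquely as $Z=\beta_1\mathbf{e_1}+\beta_2\mathbf{e_2}$ with $\beta_1=Z_1-\mathbf{i}Z_2$, $\beta_2=Z_1+\mathbf{i}Z_2$ in $\mathbb{C}(\mathbf{i})$; operations are componentwise in this representation. $\mathcal{O}_0=\mathcal{O}\cup\{0\}$, where $\mathcal{O}=\{Z=Z_1+\mathbf{j}Z_2\ne0: Z_1^2+Z_2^2=0\}$ is the set of zero divisors, so $Z\in\mathcal{O}_0$ iff $\beta_1=0$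 or $\beta_2=0$. A set $\Omega\subset\mathbb{BC}$ is product-type if $\Omega=\Omega_1\mathbf{e_1}+\Omega_2\mathbf{e_2}$ with $\Omega_1,\Omega_2\subset\mathbb{C}(\mathbf{i})$. A function $F:\Omega\to\mathbb{BC}$ is product-type if there are $F_l:\Omega_l\to\mathbb{C}(\mathbf{i})$, $l=1,2$, with $F(\beta_1\mathbf{e_1}+\beta_2\mathbf{e_2})=F_1(\beta_1)\mathbf{e_1}+F_2(\beta_2)\mathbf{e_2}$ on $\Omega$. $F$ is $\mathbb{BC}$-holomorphic on an open set $\Omega$ if for every $Z_0\in\Omega$ the limit $F'(Z_0)$ of $\frac{F(Z)-F(Z_0)}{Z-Z_0}$ as $Z\to Z_0$ with $Z-Z_0\notin\mathcal{O}_0$ exists. $F$ is $\mathbb{BC}$-univalent on a product-type open set $\Omega$ if $F$ is product-type and $F(Z)\ne F(W)$ for all distinct $Z,W\in\Omega$. The bicomplex unit disk is $\mathbb{D}_{\mathbb{BC}}=\{\beta_1\mathbf{e_1}+\beta_2\mathbf{e_2}:|\beta_1|<1,\ |\beta_2|<1\}$, and the bicomplex disk $\mathbb{D}(0,\frac14)$ is $\{\beta_1\mathbf{e_1}+\beta_2\mathbf{e_2}:|\beta_1|<\frac14,\ |\beta_2|<\frac14\}$.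
   Formalization: The function F is additionally assumed to be normalized by F(0)=0 and F'(0)=1; without a normalization the claim is false, e.g. for F(Z)=Z+2 (range misses 0) or F(Z)=Z/8 (range too small). *)

theory Defs
  imports "HOL-Analysis.Analysis"
begin

section \<open>Bicomplex numbers\<close>

text \<open>\<open>BC z w\<close> stands for \<open>z + j w\<close> with \<open>z, w\<close> in \<open>C(i)\<close>, the type \<^typ>\<open>complex\<close>.\<close>

datatype bicomplex = BC (bc1: complex) (bc2: complex)

lemma bicomplex_eq_iff: "Z = W \<longleftrightarrow> bc1 Z = bc1 W \<and> bc2 Z = bc2 W"
  by (auto intro: bicomplex.expand)

instantiation bicomplex :: comm_ring_1
begin
definition "0 = BC 0 0"
definition "1 = BC 1 0"
definition "Z + W = BC (bc1 Z + bc1 W) (bc2 Z + bc2 W)"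
definition "Z - W = BC (bc1 Z - bc1 W) (bc2 Z - bc2 W)"
definition "- Z = BC (- bc1 Z) (- bc2 Z)"
definition "Z * W = BC (bc1 Z * bc1 W - bc2 Z * bc2 W) (bc1 Z * bc2 W + bc2 Z * bc1 W)"
instance
  by standard
    (simp_all add: zero_bicomplex_def one_bicomplex_def plus_bicomplex_def minus_bicomplex_def
      uminus_bicomplex_def times_bicomplex_def algebra_simps)
end

lemma bicomplex_sel [simp]:
  "bc1 0 = 0" "bc2 0 = 0" "bc1 1 = 1" "bc2 1 = 0"
  "bc1 (Z + W) = bc1 Z + bc1 W" "bc2 (Z + W) = bc2 Z + bc2 W"
  "bc1 (Z - W) = bc1 Z - bc1 W" "bc2 (Z - W) = bc2 Z - bc2 W"
  "bc1 (- Z) = - bc1 Z" "bc2 (- Z) = - bc2 Z"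
  "bc1 (Z * W) = bc1 Z * bc1 W - bc2 Z * bc2 W"
  "bc2 (Z * W) = bc1 Z * bc2 W + bc2 Z * bc1 W"
  by (simp_all add: zero_bicomplex_def one_bicomplex_def plus_bicomplex_def minus_bicomplex_def
      uminus_bicomplex_def times_bicomplex_def)

text \<open>\<open>1/(z + j w) = (z - j w)/(z\<^sup>2 + w\<^sup>2)\<close>. As in any \<open>inverse\<close> class the operation is total:
  on zero and the zero divisors the value is the junk value 0 (cf. \<open>bicomplex_right_inverse\<close> below).\<close>

instantiation bicomplex :: inverse
begin
definition "inverse Z = BC (bc1 Z / ((bc1 Z)\<^sup>2 + (bc2 Z)\<^sup>2)) (- bc2 Z / ((bc1 Z)\<^sup>2 + (bc2 Z)\<^sup>2))"
definition "Z div W = Z * inverse (W :: bicomplex)"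
instance ..
end

instantiation bicomplex :: real_vector
begin
definition "scaleR r Z = BC (r *\<^sub>R bc1 Z) (r *\<^sub>R bc2 Z)"
instance
  by standard
    (simp_all add: bicomplex_eq_iff scaleR_bicomplex_def scaleR_right_distrib scaleR_left_distrib)
end

text \<open>The topology is that of \<open>C\<^sup>2\<close>, given by the Euclidean norm. This norm is not submultiplicative,
  so \<open>bicomplex\<close> is only made a normed vector space, not a normed algebra.\<close>

instantiation bicomplex :: real_normed_vector
begin
definition "norm Z = sqrt ((cmod (bc1 Z))\<^sup>2 + (cmod (bc2 Z))\<^sup>2)"
definition "sgn (Z :: bicomplex) = Z /\<^sub>R norm Z"
definition "dist (Z :: bicomplex) W = norm (Z - W)"
definition uniformity_bicomplex :: "(bicomplex \<times> bicomplex) filter"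
  where "uniformity_bicomplex = (INF e\<in>{0<..}. principal {(x, y). dist x y < e})"
definition open_bicomplex :: "bicomplex set \<Rightarrow> bool"
  where "open_bicomplex U \<longleftrightarrow> (\<forall>x\<in>U. eventually (\<lambda>(x', y). x' = x \<longrightarrow> y \<in> U) uniformity)"
instance
proof
  fix r :: real and Z W :: bicomplex and U :: "bicomplex set"
  have np: "norm Z = norm (bc1 Z, bc2 Z)" for Z :: bicomplex
    by (simp add: norm_bicomplex_def norm_prod_def)
  show "norm Z = 0 \<longleftrightarrow> Z = 0"
    by (simp add: np zero_prod_def bicomplex_eq_iff)
  show "norm (Z + W) \<le> norm Z + norm W"
    using norm_triangle_ineq[of "(bc1 Z, bc2 Z)" "(bc1 W, bc2 W)"] by (simp add: np)
  show "norm (r *\<^sub>R Z) = \<bar>r\<bar> * norm Z"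
    using norm_scaleR[of r "(bc1 Z, bc2 Z)"] by (simp add: np scaleR_bicomplex_def del: norm_scaleR)
  show "sgn Z = Z /\<^sub>R norm Z" by (rule sgn_bicomplex_def)
  show "dist Z W = norm (Z - W)" by (rule dist_bicomplex_def)
  show "uniformity = (INF e\<in>{0<..}. principal {(x, y :: bicomplex). dist x y < e})"
    by (rule uniformity_bicomplex_def)
  show "open U \<longleftrightarrow> (\<forall>x\<in>U. eventually (\<lambda>(x', y). x' = x \<longrightarrow> y \<in> U) uniformity)"
    by (rule open_bicomplex_def)
qed
end

definition of_complex :: "complex \<Rightarrow> bicomplex" where
  "of_complex z = BC z 0"

definition bc_i :: bicomplex where "bc_i = of_complex \<i>"
definition bc_j :: bicomplex where "bc_j = BC 0 1"
definition bc_k :: bicomplex where "bc_k = bc_i * bc_j"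

definition e1 :: bicomplex where "e1 = of_complex (1/2) * (1 + bc_k)"
definition e2 :: bicomplex where "e2 = of_complex (1/2) * (1 - bc_k)"

definition zero_divisors :: "bicomplex set" where
  "zero_divisors = {Z. Z \<noteq> 0 \<and> (bc1 Z)\<^sup>2 + (bc2 Z)\<^sup>2 = 0}"

definition zero_divisors0 :: "bicomplex set" where
  "zero_divisors0 = zero_divisors \<union> {0}"

definition idem_comb :: "complex \<Rightarrow> complex \<Rightarrow> bicomplex" where
  "idem_comb \<beta>1 \<beta>2 = of_complex \<beta>1 * e1 + of_complex \<beta>2 * e2"

lemma bc_units: "bc_i * bc_i = -1" "bc_j * bc_j = -1" "bc_j * bc_i = bc_k"
  by (simp_all add: bicomplex_eq_iff bc_i_def bc_j_def bc_k_def of_complex_def)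

lemma BC_eq: "BC z w = of_complex z + bc_j * of_complex w"
  by (simp add: bicomplex_eq_iff bc_j_def of_complex_def)

lemma e1_e2: "e1 + e2 = 1" "e1 * e2 = 0" "e1 * e1 = e1" "e2 * e2 = e2"
  by (simp_all add: bicomplex_eq_iff e1_def e2_def bc_i_def bc_j_def bc_k_def of_complex_def)

lemma idem_comb_eq_iff: "Z = idem_comb \<beta>1 \<beta>2 \<longleftrightarrow> \<beta>1 = bc1 Z - \<i> * bc2 Z \<and> \<beta>2 = bc1 Z + \<i> * bc2 Z"
  by (auto simp: idem_comb_def bicomplex_eq_iff e1_def e2_def bc_i_def bc_j_def bc_k_def of_complex_def
      field_simps complex_eq_iff)

lemma idem_comb_in_zero_divisors0_iff: "idem_comb \<beta>1 \<beta>2 \<in> zero_divisors0 \<longleftrightarrow> \<beta>1 = 0 \<or> \<beta>2 = 0"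
proof -
  define Z where "Z = idem_comb \<beta>1 \<beta>2"
  have "\<beta>1 * \<beta>2 = (bc1 Z)\<^sup>2 + (bc2 Z)\<^sup>2"
  proof -
    have "\<beta>1 = bc1 Z - \<i> * bc2 Z" "\<beta>2 = bc1 Z + \<i> * bc2 Z"
      using idem_comb_eq_iff[of Z \<beta>1 \<beta>2] by (simp_all only: Z_def simp_thms)
    then show ?thesis by (simp only:) (simp add: power2_eq_square algebra_simps)
  qed
  moreover have "Z \<in> zero_divisors0 \<longleftrightarrow> (bc1 Z)\<^sup>2 + (bc2 Z)\<^sup>2 = 0"
    by (auto simp: zero_divisors0_def zero_divisors_def)
  ultimately show ?thesis by (metis Z_def mult_eq_0_iff)
qed

lemma bicomplex_right_inverse:
  assumes "Z \<notin> zero_divisors0"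
  shows "Z * inverse Z = 1"
proof -
  have "(bc1 Z)\<^sup>2 + (bc2 Z)\<^sup>2 \<noteq> 0"
    using assms by (auto simp: zero_divisors0_def zero_divisors_def)
  then show ?thesis
    by (simp add: bicomplex_eq_iff inverse_bicomplex_def power2_eq_square flip: add_divide_distrib)
qed


section \<open>Product-type sets and functions, holomorphy, univalence\<close>

definition prod_set :: "complex set \<Rightarrow> complex set \<Rightarrow> bicomplex set" where
  "prod_set \<Omega>1 \<Omega>2 = {idem_comb \<beta>1 \<beta>2 | \<beta>1 \<beta>2. \<beta>1 \<in> \<Omega>1 \<and> \<beta>2 \<in> \<Omega>2}"

definition product_type_set :: "bicomplex set \<Rightarrow> bool" where
  "product_type_set \<Omega> \<longleftrightarrow> (\<exists>\<Omega>1 \<Omega>2. \<Omega> = prod_set \<Omega>1 \<Omega>2)"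

text \<open>A function on \<open>\<Omega>\<close> is a total function of which only the values on \<open>\<Omega>\<close> matter.\<close>

definition product_type_on :: "(bicomplex \<Rightarrow> bicomplex) \<Rightarrow> bicomplex set \<Rightarrow> bool" where
  "product_type_on F \<Omega> \<longleftrightarrow>
    (\<exists>\<Omega>1 \<Omega>2 F1 F2. \<Omega> = prod_set \<Omega>1 \<Omega>2 \<and>
      (\<forall>\<beta>1\<in>\<Omega>1. \<forall>\<beta>2\<in>\<Omega>2. F (idem_comb \<beta>1 \<beta>2) = idem_comb (F1 \<beta>1) (F2 \<beta>2)))"

definition has_bc_derivative ::
  "(bicomplex \<Rightarrow> bicomplex) \<Rightarrow> bicomplex \<Rightarrow> bicomplex \<Rightarrow> bicomplex set \<Rightarrow> bool" where
  "has_bc_derivative F L Z0 \<Omega> \<longleftrightarrow>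
    ((\<lambda>Z. (F Z - F Z0) / (Z - Z0)) \<longlongrightarrow> L) (at Z0 within {Z \<in> \<Omega>. Z - Z0 \<notin> zero_divisors0})"

definition bc_holomorphic_on :: "(bicomplex \<Rightarrow> bicomplex) \<Rightarrow> bicomplex set \<Rightarrow> bool" where
  "bc_holomorphic_on F \<Omega> \<longleftrightarrow> open \<Omega> \<and> (\<forall>Z0\<in>\<Omega>. \<exists>L. has_bc_derivative F L Z0 \<Omega>)"

definition bc_univalent_on :: "(bicomplex \<Rightarrow> bicomplex) \<Rightarrow> bicomplex set \<Rightarrow> bool" where
  "bc_univalent_on F \<Omega> \<longleftrightarrow>
    open \<Omega> \<and> product_type_set \<Omega> \<and> product_type_on F \<Omega> \<and>
    (\<forall>Z\<in>\<Omega>. \<forall>W\<in>\<Omega>. Z \<noteq> W \<longrightarrow> F Z \<noteq> F W)"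

text \<open>\<open>bc_disk r\<close> is the bicomplex disk \<open>D(0, r)\<close>; the bicomplex unit disk is \<open>bc_disk 1\<close>.\<close>

definition bc_disk :: "real \<Rightarrow> bicomplex set" where
  "bc_disk r = {idem_comb \<beta>1 \<beta>2 | \<beta>1 \<beta>2. cmod \<beta>1 < r \<and> cmod \<beta>2 < r}"

end

theory Submission
  imports Defs "HOL-Complex_Analysis.Complex_Analysis"
begin

text \<open>
  In idempotent coordinates \<open>F\<close> is a pair of independent functions \<open>F1, F2\<close> on the complex unit
  disk. Moving a bicomplex point by a complex increment \<open>t\<close> moves both coordinates by \<open>t\<close>, and
  such an increment is never a zero divisor; so \<open>F1\<close> and \<open>F2\<close> are holomorphic, and both are
  univalent with value \<open>0\<close> and derivative \<open>1\<close> at the origin. The claim is then the classical Koebe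
  quarter theorem (\<open>koebe_quarter\<close>) for each of them. What remains is a proof of that theorem.

  Suppose that a univalent \<open>f\<close> on the unit disk omits \<open>w\<close>. The square root \<open>h\<close> of
  \<open>(w - f)/(w - f 0)\<close> with \<open>h 0 = 1\<close> is univalent and never vanishes. If \<open>h z = - h z'\<close>, then the
  squares agree, so \<open>z = z'\<close> and \<open>h z = 0\<close>; hence \<open>h z + h z' \<noteq> 0\<close> throughout. Therefore
  \<open>\<phi> = (1 - h)/(1 + h)\<close> is univalent, vanishes at \<open>0\<close>, and \<open>\<phi> z * \<phi> z'\<close> is
  never \<open>1\<close>. As \<open>\<phi>'(0) = f'(0)/(4 (w - f 0))\<close>, the quarter theorem is the bound \<open>\<bar>\<phi>'(0)\<bar> \<le> 1\<close> (\<open>bieberbach_eilenberg_univalent\<close>).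

  This bound compares areas in the metric \<open>\<bar>dw\<bar>/\<bar>w\<bar>\<close>. The image under \<open>\<phi>\<close> of the annulus
  \<open>\<epsilon> < \<bar>z\<bar> < r\<close> has area at least \<open>2\<pi> ln (r/\<epsilon>)\<close>. The metric is invariant under \<open>w \<mapsto> 1/w\<close>, so the
  reciprocal of this image has the same area; it is disjoint from the image by hypothesis. Both lie
  in an annulus which, for small \<open>\<epsilon>\<close>, is about \<open>\<epsilon>\<bar>\<phi>'(0)\<bar> < \<bar>w\<bar> < 1/(\<epsilon>\<bar>\<phi>'(0)\<bar>)\<close>, of area
  \<open>4\<pi> ln (1/(\<epsilon>\<bar>\<phi>'(0)\<bar>))\<close>. The divergent terms cancel and leave \<open>ln \<bar>\<phi>'(0)\<bar> \<le> - ln r\<close>;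
  now \<open>r\<close> tends to \<open>1\<close>.

  The metric \<open>\<bar>dw\<bar>/\<bar>w\<bar>\<close> becomes Euclidean in the coordinate \<open>ln w\<close>. So the argument
  takes place on rectangles in the left half-plane with the map \<open>G \<zeta> = \<zeta> + L (exp \<zeta>)\<close>, where
  \<open>\<phi> z = z * exp (L z)\<close>, and the reciprocal becomes the negative.
\<close>

section \<open>Area of holomorphic images of rectangles\<close>

text \<open>Areas are measured in \<^typ>\<open>real^2\<close>, where the change of variables formula is a statement about
  the Jacobian determinant; \<open>to_vec\<close> and \<open>of_vec\<close> identify the complex plane with it.\<close>

definition to_vec :: "complex \<Rightarrow> real^2" where
  "to_vec z = vector [Re z, Im z]"

definition of_vec :: "real^2 \<Rightarrow> complex" where
  "of_vec v = Complex (v$1) (v$2)"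

lemma of_vec_to_vec [simp]: "of_vec (to_vec z) = z"
  by (simp add: of_vec_def to_vec_def)

lemma to_vec_of_vec [simp]: "to_vec (of_vec v) = v"
  by (simp add: of_vec_def to_vec_def vec_eq_iff forall_2)

lemma to_vec_eq_iff [simp]: "to_vec z = to_vec w \<longleftrightarrow> z = w"
  by (metis of_vec_to_vec)

lemma bounded_linear_of_vec: "bounded_linear of_vec"
  by (rule linear_conv_bounded_linear[THEN iffD1], rule linearI)
     (auto simp: of_vec_def complex_eq_iff)

lemma bounded_linear_to_vec: "bounded_linear to_vec"
  by (rule linear_conv_bounded_linear[THEN iffD1], rule linearI)
     (auto simp: to_vec_def vec_eq_iff forall_2)

lemma mem_cbox_vec_iff:
  "v \<in> cbox (to_vec a) (to_vec b) \<longleftrightarrow> of_vec v \<in> cbox a b"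
  by (auto simp: mem_box_cart forall_2 to_vec_def of_vec_def in_cbox_complex_iff)

lemma to_vec_image_cbox: "to_vec ` cbox a b = cbox (to_vec a) (to_vec b)"
  by (auto simp: mem_cbox_vec_iff image_iff) (metis to_vec_of_vec)

lemma measure_cbox_vec:
  assumes "Re a \<le> Re b" "Im a \<le> Im b"
  shows "measure lebesgue (cbox (to_vec a) (to_vec b)) = (Re b - Re a) * (Im b - Im a)"
proof -
  have "cbox (to_vec a) (to_vec b) \<noteq> {}"
    using assms by (auto simp: interval_ne_empty_cart forall_2 to_vec_def)
  then show ?thesis
    by (simp add: content_cbox_cart UNIV_2 to_vec_def)
qed

lemma has_derivative_vec:
  assumes "(G has_field_derivative d) (at (of_vec v))"
  shows "((\<lambda>v. to_vec (G (of_vec v))) has_derivative (\<lambda>h. to_vec (d * of_vec h))) (at v within S)"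
proof -
  have "((\<lambda>v. G (of_vec v)) has_derivative (\<lambda>h. d * of_vec h)) (at v within S)"
    using bounded_linear_imp_has_derivative[OF bounded_linear_of_vec] assms
    unfolding has_field_derivative_def by (rule has_derivative_compose)
  then show ?thesis
    by (rule bounded_linear.has_derivative[OF bounded_linear_to_vec])
qed

lemma det_complex_mult: "det (matrix (\<lambda>h. to_vec (d * of_vec h))) = (cmod d)\<^sup>2"
  by (simp add: det_2 matrix_def to_vec_def of_vec_def axis_def cmod_power2 flip: power2_eq_square)

text \<open>This is Fubini's theorem on \<^typ>\<open>real \<times> real\<close> in other coordinates: the bijection
  from \<^typ>\<open>real^2\<close> maps boxes to boxes of the same content and so preserves integrals.\<close>

lemma has_integral_vec_cbox:
  fixes f :: "complex \<Rightarrow> complex"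
  assumes "continuous_on (cbox a b) f"
  shows "((\<lambda>v. f (of_vec v)) has_integral
           integral {Re a..Re b} (\<lambda>x. integral {Im a..Im b} (\<lambda>y. f (Complex x y))))
         (cbox (to_vec a) (to_vec b))"
proof -
  define g :: "real^2 \<Rightarrow> real \<times> real" where "g v = (v$1, v$2)" for v
  define h :: "real \<times> real \<Rightarrow> real^2" where "h p = vector [fst p, snd p]" for p
  define F where "F p = f (Complex (fst p) (snd p))" for p
  have hg: "h (g v) = v" and gh: "g (h p) = p" for v p
    by (simp_all add: g_def h_def vec_eq_iff forall_2)
  have gim: "g ` cbox u v = cbox (g u) (g v)" for u v
  proof -
    have "p \<in> cbox (g u) (g v) \<longleftrightarrow> h p \<in> cbox u v" for p
      by (cases p) (auto simp: mem_box_cart forall_2 g_def h_def cbox_Pair_eq)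
    then show ?thesis
      using hg gh by (auto simp: set_eq_iff image_iff simp del: split_paired_All) metis+
  qed
  have him: "h ` cbox p q = cbox (h p) (h q)" for p q
  proof -
    have "cbox p q = g ` cbox (h p) (h q)" by (simp add: gim gh)
    then show ?thesis by (simp add: image_image hg)
  qed
  have cont: "measure lborel (g ` cbox u v) = measure lborel (cbox u v)" for u v
  proof (cases "cbox u v = {}")
    case False
    then have "u$1 \<le> v$1" "u$2 \<le> v$2" by (auto simp: interval_ne_empty_cart)
    then show ?thesis
      unfolding gim using False by (simp add: content_cbox_cart UNIV_2 g_def content_Pair)
  qed simp
  have contg: "isCont g v" for v
    unfolding g_def by (intro continuous_intros)
  have contF: "continuous_on (cbox (Re a, Im a) (Re b, Im b)) F"
    unfolding F_def
    by (rule continuous_on_compose2[OF assms])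
       (auto simp: cbox_Pair_eq in_cbox_complex_iff intro!: continuous_intros)
  have "(F has_integral integral (cbox (Re a, Im a) (Re b, Im b)) F) (cbox (Re a, Im a) (Re b, Im b))"
    using contF integrable_continuous integrable_integral by blast
  then have "((\<lambda>v. F (g v)) has_integral (1/1) *\<^sub>R integral (cbox (Re a, Im a) (Re b, Im b)) F)
       (h ` cbox (Re a, Im a) (Re b, Im b))"
  proof (rule has_integral_twiddle[rotated -1, where r = 1])
    show "\<exists>w z. g ` cbox u v = cbox w z" "\<exists>w z. h ` cbox p q = cbox w z" for u v p q
      using gim him by blast+
  qed (use hg gh contg cont in auto)
  moreover have "h ` cbox (Re a, Im a) (Re b, Im b) = cbox (to_vec a) (to_vec b)"
    unfolding him by (simp add: h_def to_vec_def)
  ultimately show ?thesis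
    using integral_prod_continuous[OF contF] by (simp add: F_def g_def of_vec_def)
qed

text \<open>The area of the image is the integral of \<open>\<bar>G'\<bar>\<^sup>2\<close>, and \<open>\<bar>G' - c\<bar>\<^sup>2 \<ge> 0\<close> bounds the integrand below by
  \<open>2 Re (cnj c * G') - \<bar>c\<bar>\<^sup>2\<close>, which is linear in \<open>G'\<close>. Along each vertical segment of the rectangle the
  integral of \<open>G'\<close> is fixed by the increment of \<open>G\<close>, which is that of the linear map \<open>\<zeta> \<mapsto> c \<zeta>\<close>.
  Thus among the maps with these increments the linear one has the smallest image.\<close>

lemma area_image_ge:
  assumes "open U" "cbox a b \<subseteq> U" and holo: "G holomorphic_on U" and inj: "inj_on G (cbox a b)"
    and ab: "Re a \<le> Re b" "Im a \<le> Im b"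
    and step: "\<And>x. Re a \<le> x \<Longrightarrow> x \<le> Re b \<Longrightarrow>
      G (Complex x (Im b)) - G (Complex x (Im a)) = c * (\<i> * (Im b - Im a))"
  shows "to_vec ` G ` cbox a b \<in> lmeasurable"
    and "(cmod c)\<^sup>2 * ((Re b - Re a) * (Im b - Im a)) \<le> measure lebesgue (to_vec ` G ` cbox a b)"
proof -
  define R where "R = cbox (to_vec a) (to_vec b)"
  define GG where "GG v = to_vec (G (of_vec v))" for v
  have inR: "of_vec v \<in> cbox a b" if "v \<in> R" for v
    using that by (simp add: R_def mem_cbox_vec_iff)
  have der: "(G has_field_derivative deriv G z) (at z)" if "z \<in> cbox a b" for z
    using that assms by (meson holomorphic_derivI subsetD)
  have contd: "continuous_on (cbox a b) (deriv G)"
    using assms by (meson holomorphic_deriv holomorphic_on_imp_continuous_on continuous_on_subset)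
  have img: "to_vec ` G ` cbox a b = GG ` R"
    by (simp add: GG_def R_def image_image flip: to_vec_image_cbox)
  have injG: "inj_on GG R"
    using inj unfolding inj_on_def GG_def by (metis inR to_vec_eq_iff to_vec_of_vec)
  have contR: "continuous_on R (\<lambda>v. deriv G (of_vec v))"
    by (rule continuous_on_compose2[OF contd])
       (auto simp: inR intro!: linear_continuous_on bounded_linear_of_vec)
  define J where "J = integral R (\<lambda>v. (cmod (deriv G (of_vec v)))\<^sup>2)"
  have J: "((\<lambda>v. (cmod (deriv G (of_vec v)))\<^sup>2) has_integral J) R"
    unfolding J_def R_def
    by (rule integrable_integral, rule integrable_continuous)
       (intro continuous_intros contR[unfolded R_def])
  have meas: "GG ` R \<in> lmeasurable \<and> measure lebesgue (GG ` R) = J"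
  proof (rule has_measure_differentiable_image[THEN iffD2])
    show "(GG has_derivative (\<lambda>h. to_vec (deriv G (of_vec v) * of_vec h))) (at v within R)"
      if "v \<in> R" for v
      unfolding GG_def by (rule has_derivative_vec, rule der, rule inR, rule that)
  qed (use injG J in \<open>simp_all add: det_complex_mult R_def\<close>)
  define I where "I = integral {Re a..Re b} (\<lambda>x. integral {Im a..Im b} (\<lambda>y. deriv G (Complex x y)))"
  have "integral {Im a..Im b} (\<lambda>y. deriv G (Complex x y)) = c * (Im b - Im a)"
    if x: "x \<in> {Re a..Re b}" for x
  proof -
    have "((\<lambda>y. deriv G (Complex x y)) has_integral
            (- \<i> * G (Complex x (Im b))) - (- \<i> * G (Complex x (Im a)))) {Im a..Im b}"
    proof (rule fundamental_theorem_of_calculus)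
      show "Im a \<le> Im b" by fact
      fix y assume "y \<in> {Im a..Im b}"
      with x have "(G has_field_derivative deriv G (Complex x y)) (at (Complex x y))"
        by (intro der) (auto simp: in_cbox_complex_iff)
      moreover have "((\<lambda>y. Complex x y) has_vector_derivative \<i>) (at y within {Im a..Im b})"
        unfolding Complex_eq by (auto intro!: derivative_eq_intros)
      ultimately have "((\<lambda>y. G (Complex x y)) has_vector_derivative \<i> * deriv G (Complex x y))
              (at y within {Im a..Im b})"
        using field_vector_diff_chain_within[of "Complex x" \<i> y "{Im a..Im b}" G]
        by (auto simp: o_def dest: has_field_derivative_at_within)
      from has_vector_derivative_mult_right[OF this, of "- \<i>"]
      show "((\<lambda>y. - \<i> * G (Complex x y)) has_vector_derivative deriv G (Complex x y))
              (at y within {Im a..Im b})"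
        by simp
    qed
    moreover have "(- \<i> * G (Complex x (Im b))) - (- \<i> * G (Complex x (Im a))) = c * (Im b - Im a)"
    proof -
      have "(- \<i> * G (Complex x (Im b))) - (- \<i> * G (Complex x (Im a)))
          = - \<i> * (G (Complex x (Im b)) - G (Complex x (Im a)))" by (simp add: algebra_simps)
      also have "G (Complex x (Im b)) - G (Complex x (Im a)) = c * (\<i> * (Im b - Im a))"
        using step[of x] x by simp
      also have "- \<i> * (c * (\<i> * (Im b - Im a))) = - (\<i> * \<i>) * (c * (Im b - Im a))"
        by (simp only: mult.left_commute[of c] mult.assoc mult_minus_left)
      also have "\<dots> = c * (Im b - Im a)" by simp
      finally show ?thesis .
    qed
    ultimately show ?thesis by (simp add: integral_unique)
  qed
  then have "I = integral {Re a..Re b} (\<lambda>x. c * (Im b - Im a))"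
    unfolding I_def by (intro integral_cong) auto
  then have I: "I = c * ((Re b - Re a) * (Im b - Im a))"
    using ab by (simp add: scaleR_conv_of_real)
  have "((\<lambda>v. deriv G (of_vec v)) has_integral I) R"
    unfolding I_def R_def by (rule has_integral_vec_cbox[OF contd])
  then have "((\<lambda>v. 2 * Re (cnj c * deriv G (of_vec v)) - (cmod c)\<^sup>2) has_integral
      2 * Re (cnj c * I) - measure lebesgue R * (cmod c)\<^sup>2) R"
    unfolding R_def
    by (intro has_integral_diff has_integral_mult_right has_integral_Re)
       (use has_integral_const[of "(cmod c)\<^sup>2" "to_vec a" "to_vec b"] in auto)
  moreover have "2 * Re (cnj c * I) - measure lebesgue R * (cmod c)\<^sup>2
     = (cmod c)\<^sup>2 * ((Re b - Re a) * (Im b - Im a))"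
  proof -
    have "cnj c * I = complex_of_real ((cmod c)\<^sup>2 * ((Re b - Re a) * (Im b - Im a)))"
      by (simp add: I complex_norm_square del: of_real_power)
    then have "Re (cnj c * I) = (cmod c)\<^sup>2 * ((Re b - Re a) * (Im b - Im a))"
      by (metis Re_complex_of_real)
    then show ?thesis
      unfolding R_def using measure_cbox_vec[OF ab] by simp
  qed
  ultimately have "((\<lambda>v. 2 * Re (cnj c * deriv G (of_vec v)) - (cmod c)\<^sup>2) has_integral
      (cmod c)\<^sup>2 * ((Re b - Re a) * (Im b - Im a))) R" by simp
  then have "(cmod c)\<^sup>2 * ((Re b - Re a) * (Im b - Im a)) \<le> J"
  proof (rule has_integral_le[OF _ J])
    fix v
    have "(cmod (d - c))\<^sup>2 = (cmod d)\<^sup>2 - (2 * Re (cnj c * d) - (cmod c)\<^sup>2)" for d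
      unfolding cmod_power2 by (simp add: power2_eq_square algebra_simps)
    then show "2 * Re (cnj c * deriv G (of_vec v)) - (cmod c)\<^sup>2 \<le> (cmod (deriv G (of_vec v)))\<^sup>2"
      by (metis diff_ge_0_iff_ge zero_le_power2)
  qed
  with meas show "to_vec ` G ` cbox a b \<in> lmeasurable"
    and "(cmod c)\<^sup>2 * ((Re b - Re a) * (Im b - Im a)) \<le> measure lebesgue (to_vec ` G ` cbox a b)"
    by (simp_all add: img)
qed

section \<open>The logarithmic area principle\<close>

text \<open>Let \<open>G \<zeta> = \<zeta> + L (exp \<zeta>)\<close>. The images of \<open>[s, t] \<times> [0, Y]\<close> under \<open>G\<close> and \<open>\<i> Y - G\<close> are
  disjoint, have area at least
  \<open>(t - s) Y\<close> each, and lie in \<open>[-M, M] \<times> [-C, Y + C]\<close>. With \<open>Y\<close> a multiple of \<open>2\<pi>\<close>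
  the increment of \<open>G\<close> from the bottom to the top side is exactly \<open>\<i> Y\<close>, and letting \<open>Y\<close> grow makes
  the contribution of \<open>C\<close> negligible. A long rectangle takes the place of a single period, whose image
  would have to be reduced modulo \<open>2\<pi>\<i>\<close> before areas could be compared.\<close>

lemma log_area_comparison:
  assumes holL: "L holomorphic_on ball 0 1"
    and inj: "inj_on (\<lambda>z. z * exp (L z)) (ball 0 1)"
    and ne1: "\<And>z w. z \<in> ball 0 1 \<Longrightarrow> w \<in> ball 0 1 \<Longrightarrow> (z * exp (L z)) * (w * exp (L w)) \<noteq> 1"
    and st: "s \<le> t" "t < 0"
    and C: "\<And>z. cmod z \<le> exp t \<Longrightarrow> cmod (L z) \<le> C"
    and M: "\<And>\<zeta>. s \<le> Re \<zeta> \<Longrightarrow> Re \<zeta> \<le> t \<Longrightarrow> \<bar>Re (\<zeta> + L (exp \<zeta>))\<bar> \<le> M"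
  shows "t - s \<le> M"
proof (rule ccontr)
  assume "\<not> t - s \<le> M"
  then have gap: "0 < t - s - M" by simp
  have C0: "0 \<le> C" using C[of 0] norm_ge_zero[of "L 0"] by (simp del: norm_ge_zero)
  have M0: "0 \<le> M" using M[of "of_real s"] st by simp
  \<comment> \<open>Chosen so that the gain \<open>(t - s - M) Y\<close> of the tall rectangle exceeds the boundary loss \<open>2 M C\<close>.\<close>
  obtain N :: nat where N: "2 * M * C / (t - s - M) < N"
    using reals_Archimedean2 by blast
  define Y where "Y = 2 * pi * N"
  have Y0: "0 \<le> Y" by (simp add: Y_def)
  have expY: "exp (\<i> * Y) = 1"
    using exp_integer_2pi[of "of_nat N"] by (simp add: Y_def mult_ac)
  define U where "U = {\<zeta>::complex. Re \<zeta> < 0}"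
  define R where "R = cbox (Complex s 0) (Complex t Y)"
  define G where "G \<zeta> = \<zeta> + L (exp \<zeta>)" for \<zeta>
  define G' where "G' \<zeta> = \<i> * Y - G \<zeta>" for \<zeta>
  have openU: "open U" by (simp add: U_def open_halfspace_Re_lt)
  have RU: "R \<subseteq> U" using st by (auto simp: R_def U_def in_cbox_complex_iff)
  have holG: "G holomorphic_on U"
    unfolding G_def
    by (intro holomorphic_intros holomorphic_on_compose_gen[OF _ holL, unfolded o_def])
       (auto simp: U_def)
  then have holG': "G' holomorphic_on U"
    unfolding G'_def by (intro holomorphic_intros)
  have expG: "exp (G \<zeta>) = exp \<zeta> * exp (L (exp \<zeta>))" for \<zeta>
    by (simp add: G_def exp_add)
  have in_ball: "exp \<zeta> \<in> ball 0 1" if "\<zeta> \<in> R" for \<zeta>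
    using RU that by (auto simp: U_def)
  have injG: "inj_on G R"
  proof (rule inj_onI)
    fix \<zeta> \<zeta>' assume *: "\<zeta> \<in> R" "\<zeta>' \<in> R" "G \<zeta> = G \<zeta>'"
    then have "exp \<zeta> * exp (L (exp \<zeta>)) = exp \<zeta>' * exp (L (exp \<zeta>'))"
      by (metis expG)
    with inj * have "exp \<zeta> = exp \<zeta>'"
      by (auto dest: inj_onD intro: in_ball)
    with * show "\<zeta> = \<zeta>'" by (simp add: G_def)
  qed
  then have injG': "inj_on G' R"
    by (auto simp: inj_on_def G'_def)
  have stepG: "G (Complex x Y) - G (Complex x 0) = \<i> * Y" for x
  proof -
    have "Complex x Y = Complex x 0 + \<i> * Y" by (simp add: complex_eq_iff)
    then show ?thesis by (simp add: G_def exp_add expY)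
  qed
  define A where "A = to_vec ` G ` R"
  define B where "B = to_vec ` G' ` R"
  have A: "A \<in> lmeasurable" "(t - s) * Y \<le> measure lebesgue A"
    using area_image_ge[OF openU _ holG, of "Complex s 0" "Complex t Y" 1] RU injG st Y0 stepG
    by (simp_all add: A_def R_def)
  have B: "B \<in> lmeasurable" "(t - s) * Y \<le> measure lebesgue B"
    using area_image_ge[OF openU _ holG', of "Complex s 0" "Complex t Y" "-1"] RU injG' st Y0 stepG
    by (simp_all add: B_def R_def G'_def algebra_simps)
  have "A \<inter> B = {}"
  proof -
    have "G \<zeta> \<noteq> G' \<zeta>'" if "\<zeta> \<in> R" "\<zeta>' \<in> R" for \<zeta> \<zeta>'
    proof
      assume "G \<zeta> = G' \<zeta>'"
      then have "exp (G \<zeta> + G \<zeta>') = 1" by (simp add: G'_def expY)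
      then show False
        using ne1[OF in_ball in_ball] that by (simp add: exp_add expG)
    qed
    then show ?thesis by (auto simp: A_def B_def)
  qed
  define Q where "Q = cbox (to_vec (Complex (- M) (- C))) (to_vec (Complex M (Y + C)))"
  have bound: "\<bar>Re (G \<zeta>)\<bar> \<le> M" "- C \<le> Im (G \<zeta>)" "Im (G \<zeta>) \<le> Y + C" if "\<zeta> \<in> R" for \<zeta>
  proof -
    have \<zeta>: "s \<le> Re \<zeta>" "Re \<zeta> \<le> t" "0 \<le> Im \<zeta>" "Im \<zeta> \<le> Y"
      using that by (auto simp: R_def in_cbox_complex_iff)
    then show "\<bar>Re (G \<zeta>)\<bar> \<le> M" using M by (simp add: G_def)
    have "\<bar>Im (L (exp \<zeta>))\<bar> \<le> C"
      using C[of "exp \<zeta>"] \<zeta> abs_Im_le_cmod[of "L (exp \<zeta>)"] by simp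
    with \<zeta> show "- C \<le> Im (G \<zeta>)" "Im (G \<zeta>) \<le> Y + C" by (simp_all add: G_def)
  qed
  have "A \<union> B \<subseteq> Q"
    using bound by (fastforce simp: A_def B_def Q_def mem_cbox_vec_iff in_cbox_complex_iff
        G'_def abs_le_iff)
  moreover have "measure lebesgue Q = 2 * M * (Y + 2 * C)"
    unfolding Q_def using M0 C0 Y0 by (subst measure_cbox_vec) auto
  moreover have "Q \<in> lmeasurable" by (simp add: Q_def)
  ultimately have "measure lebesgue (A \<union> B) \<le> 2 * M * (Y + 2 * C)"
    using A B by (metis measure_mono_fmeasurable fmeasurable.Un fmeasurableD)
  moreover have "measure lebesgue (A \<union> B) = measure lebesgue A + measure lebesgue B"
    using A B \<open>A \<inter> B = {}\<close> by (simp add: measure_Un3)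
  ultimately have "2 * ((t - s) * Y) \<le> 2 * M * (Y + 2 * C)"
    using A B by linarith
  then have "(t - s - M) * Y \<le> 2 * M * C" by (simp add: algebra_simps)
  moreover have "2 * M * C < (t - s - M) * N"
    using N gap by (simp add: field_simps)
  moreover have "(t - s - M) * N \<le> (t - s - M) * Y"
    using gap pi_gt3 mult_right_mono[of 1 "2 * pi" N] unfolding Y_def
    by (intro mult_left_mono) auto
  ultimately show False by linarith
qed

text \<open>Near the origin \<open>L\<close> is within \<open>\<delta>\<close> of \<open>L 0\<close>, so for \<open>s\<close> far to the left the real part of
  \<open>\<zeta> + L (exp \<zeta>)\<close> on \<open>s \<le> Re \<zeta> \<le> t\<close> is bounded in modulus by \<open>M = - s - Re (L 0) + \<delta>\<close>.
  In the comparison \<open>t - s \<le> M\<close> the number \<open>s\<close> cancels; then \<open>\<delta>\<close> and \<open>t\<close> tend to \<open>0\<close>.\<close>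

lemma log_area_principle:
  assumes holL: "L holomorphic_on ball 0 1"
    and inj: "inj_on (\<lambda>z. z * exp (L z)) (ball 0 1)"
    and ne1: "\<And>z w. z \<in> ball 0 1 \<Longrightarrow> w \<in> ball 0 1 \<Longrightarrow> (z * exp (L z)) * (w * exp (L w)) \<noteq> 1"
  shows "Re (L 0) \<le> 0"
proof -
  have key: "Re (L 0) \<le> \<delta> - t" if "0 < \<delta>" "t < 0" for \<delta> t :: real
  proof -
    have contL: "continuous_on (ball 0 1) L"
      using holL by (rule holomorphic_on_imp_continuous_on)
    have sub: "cball 0 (exp t) \<subseteq> ball (0::complex) 1"
      using \<open>t < 0\<close> by (simp add: cball_subset_ball_iff)
    have "compact (L ` cball 0 (exp t))"
      by (intro compact_continuous_image continuous_on_subset[OF contL sub] compact_cball)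
    then have "bounded (L ` cball 0 (exp t))" by (rule compact_imp_bounded)
    then obtain C where "\<And>z. z \<in> cball 0 (exp t) \<Longrightarrow> cmod (L z) \<le> C"
      unfolding bounded_iff by blast
    then have C: "cmod (L z) \<le> C" if "cmod z \<le> exp t" for z
      using that by simp
    have C0: "0 \<le> C" using C[of 0] norm_ge_zero[of "L 0"] by (simp del: norm_ge_zero)
    have "isCont L 0"
      using contL by (simp add: continuous_on_eq_continuous_at)
    then obtain \<rho> where \<rho>: "0 < \<rho>" "\<And>z. cmod z < \<rho> \<Longrightarrow> cmod (L z - L 0) < \<delta>"
      using \<open>0 < \<delta>\<close> by (auto simp: continuous_at_eps_delta dist_norm)
    \<comment> \<open>The second entry keeps the points with \<open>\<bar>exp \<zeta>\<bar> \<ge> \<rho>\<close> above \<open>- M\<close>; the third keeps all points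
      below \<open>M\<close>.\<close>
    define s where "s = min t (min (ln \<rho> - C - Re (L 0) + \<delta>) (- Re (L 0) + \<delta> - C))"
    have s: "s \<le> t" "s \<le> ln \<rho> - C - Re (L 0) + \<delta>" "s \<le> - Re (L 0) + \<delta> - C"
      by (auto simp: s_def)
    have "t - s \<le> - s - Re (L 0) + \<delta>"
    proof (rule log_area_comparison[OF holL inj ne1 \<open>s \<le> t\<close> \<open>t < 0\<close> C])
      fix \<zeta> assume \<zeta>: "s \<le> Re \<zeta>" "Re \<zeta> \<le> t"
      have le: "\<bar>Re (L (exp \<zeta>))\<bar> \<le> C"
        using C[of "exp \<zeta>"] \<zeta> abs_Re_le_cmod[of "L (exp \<zeta>)"] by simp
      have "s + Re (L 0) - \<delta> \<le> Re (\<zeta> + L (exp \<zeta>))"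
      proof (cases "cmod (exp \<zeta>) < \<rho>")
        case True
        then have "\<bar>Re (L (exp \<zeta>) - L 0)\<bar> < \<delta>"
          using \<rho>(2) abs_Re_le_cmod le_less_trans by blast
        with \<zeta> show ?thesis by simp
      next
        case False
        then have "ln \<rho> \<le> Re \<zeta>"
          using \<rho>(1) ln_mono[of \<rho> "exp (Re \<zeta>)"] by simp
        with le s show ?thesis by simp
      qed
      moreover have "Re (\<zeta> + L (exp \<zeta>)) \<le> - s - Re (L 0) + \<delta>"
        using le s \<zeta> \<open>t < 0\<close> by simp
      ultimately show "\<bar>Re (\<zeta> + L (exp \<zeta>))\<bar> \<le> - s - Re (L 0) + \<delta>"
        by simp
    qed
    then show ?thesis by simp
  qed
  show ?thesis
  proof (rule field_le_epsilon)
    fix e :: real assume "0 < e"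
    with key[of "e/2" "-e/2"] show "Re (L 0) \<le> 0 + e" by simp
  qed
qed

section \<open>The Koebe quarter theorem\<close>

text \<open>Univalence makes \<open>\<phi> z / z\<close> zero-free, also at the origin, so it has a logarithm \<open>L\<close> and
  \<open>\<bar>\<phi>'(0)\<bar> = exp (Re (L 0))\<close>.\<close>

lemma bieberbach_eilenberg_univalent:
  assumes hol: "\<phi> holomorphic_on ball 0 1" and "\<phi> 0 = 0" and inj: "inj_on \<phi> (ball 0 1)"
    and ne1: "\<And>z w. z \<in> ball 0 1 \<Longrightarrow> w \<in> ball 0 1 \<Longrightarrow> \<phi> z * \<phi> w \<noteq> 1"
  shows "cmod (deriv \<phi> 0) \<le> 1"
proof -
  obtain h where holh: "h holomorphic_on ball 0 1"
    and h: "\<And>z. cmod z < 1 \<Longrightarrow> \<phi> z = z * h z" and h0: "deriv \<phi> 0 = h 0"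
    using Schwarz3[OF hol \<open>\<phi> 0 = 0\<close>] by blast
  have "h z \<noteq> 0" if "z \<in> ball 0 1" for z
  proof (cases "z = 0")
    case True
    then show ?thesis
      using holomorphic_injective_imp_regular[OF hol _ inj, of 0] h0 by simp
  next
    case False
    then have "\<phi> z \<noteq> \<phi> 0" using inj that by (auto dest: inj_onD)
    then show ?thesis using h[of z] \<open>\<phi> 0 = 0\<close> that by auto
  qed
  then obtain L where L: "L holomorphic_on ball 0 1" "\<And>z. z \<in> ball 0 1 \<Longrightarrow> h z = exp (L z)"
    using contractible_imp_holomorphic_log[OF holh] convex_imp_contractible convex_ball by metis
  then have \<phi>: "\<phi> z = z * exp (L z)" if "z \<in> ball 0 1" for z
    using h that by simp
  have "Re (L 0) \<le> 0"
  proof (rule log_area_principle[OF L(1)])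
    show "inj_on (\<lambda>z. z * exp (L z)) (ball 0 1)"
      using inj inj_on_cong[of "ball 0 1" \<phi> "\<lambda>z. z * exp (L z)", OF \<phi>] by simp
    show "(z * exp (L z)) * (w * exp (L w)) \<noteq> 1" if "z \<in> ball 0 1" "w \<in> ball 0 1" for z w
      using ne1[OF that] \<phi> that by simp
  qed
  then show ?thesis by (simp add: h0 L)
qed

text \<open>An omitted value \<open>w\<close> gives the square root \<open>h\<close> of \<open>(w - f)/(w - f 0)\<close>, and the Cayley
  transform \<open>(1 - h)/(1 + h)\<close> turns \<open>h z + h z' \<noteq> 0\<close> into \<open>\<phi> z * \<phi> z' \<noteq> 1\<close>.\<close>

theorem koebe_quarter:
  assumes hol: "f holomorphic_on ball 0 1" and inj: "inj_on f (ball 0 1)"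
  shows "ball (f 0) (cmod (deriv f 0) / 4) \<subseteq> f ` ball 0 1"
proof (rule subsetI, rule ccontr)
  fix w assume w: "w \<in> ball (f 0) (cmod (deriv f 0) / 4)" and out: "w \<notin> f ` ball 0 1"
  have w0: "w - f 0 \<noteq> 0" using out by auto
  define g where "g z = (w - f z) / (w - f 0)" for z
  have "g holomorphic_on ball 0 1"
    unfolding g_def using w0 by (intro holomorphic_intros hol)
  moreover have "g z \<noteq> 0" if "z \<in> ball 0 1" for z
    using out that w0 by (auto simp: g_def)
  ultimately obtain k where k: "k holomorphic_on ball 0 1" "\<And>z. z \<in> ball 0 1 \<Longrightarrow> g z = (k z)\<^sup>2"
    using contractible_imp_holomorphic_sqrt[of g "ball 0 1"] convex_imp_contractible convex_ball
    by metis
  have k0: "(k 0)\<^sup>2 = 1" using k(2)[of 0] w0 by (simp add: g_def)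
  define h where "h z = k z / k 0" for z
  have h0: "h 0 = 1" using k0 by (auto simp: h_def)
  have holh: "h holomorphic_on ball 0 1"
    unfolding h_def using k0 by (intro holomorphic_intros k) auto
  have hg: "g z = (h z)\<^sup>2" if "z \<in> ball 0 1" for z
    using k(2)[OF that] k0 by (simp add: h_def power_divide)
  have h_eqD: "z = z'" if "z \<in> ball 0 1" "z' \<in> ball 0 1" "(h z)\<^sup>2 = (h z')\<^sup>2" for z z'
  proof -
    have "g z = g z'" using that hg by simp
    then have "f z = f z'" using w0 by (simp add: g_def)
    then show ?thesis using inj that by (auto dest: inj_onD)
  qed
  have hne: "h z \<noteq> 0" if "z \<in> ball 0 1" for z
    using hg[OF that] out that w0 by (auto simp: g_def)
  have hsum: "h z + h z' \<noteq> 0" if "z \<in> ball 0 1" "z' \<in> ball 0 1" for z z'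
  proof
    assume "h z + h z' = 0"
    then have eq: "h z = - h z'" by (simp add: eq_neg_iff_add_eq_0)
    then have "(h z)\<^sup>2 = (h z')\<^sup>2" by (simp only: power2_minus)
    then have "z = z'" by (rule h_eqD[OF that])
    with eq have "h z = - h z" by simp
    then show False using hne[OF that(1)] by simp
  qed
  then have h1: "1 + h z \<noteq> 0" if "z \<in> ball 0 1" for z
    using that h0 by (metis centre_in_ball zero_less_one)
  define \<phi> where "\<phi> z = (1 - h z) / (1 + h z)" for z
  have "cmod (deriv \<phi> 0) \<le> 1"
  proof (rule bieberbach_eilenberg_univalent)
    show "\<phi> holomorphic_on ball 0 1"
      unfolding \<phi>_def by (intro holomorphic_intros holh h1)
    show "\<phi> 0 = 0" by (simp add: \<phi>_def h0)
    show "inj_on \<phi> (ball 0 1)"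
    proof (rule inj_onI)
      fix z z' assume *: "z \<in> ball 0 1" "z' \<in> ball 0 1" "\<phi> z = \<phi> z'"
      have "(1 - h z) * (1 + h z') = (1 - h z') * (1 + h z)"
        using *(3) unfolding \<phi>_def frac_eq_eq[OF h1[OF *(1)] h1[OF *(2)]] .
      then have "2 * (h z - h z') = 0" by (simp add: algebra_simps)
      then have "h z = h z'" by simp
      then show "z = z'" by (intro h_eqD[OF *(1,2)]) simp
    qed
    show "\<phi> z * \<phi> z' \<noteq> 1" if "z \<in> ball 0 1" "z' \<in> ball 0 1" for z z'
    proof
      assume "\<phi> z * \<phi> z' = 1"
      then have "(1 - h z) * (1 - h z') = (1 + h z) * (1 + h z')"
        using h1[OF that(1)] h1[OF that(2)]
        by (simp only: \<phi>_def times_divide_times_eq divide_eq_1_iff)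
      then have "2 * (h z + h z') = 0" by (simp add: algebra_simps)
      then have "h z + h z' = 0" unfolding mult_eq_0_iff by simp
      then show False using hsum[OF that] by simp
    qed
  qed
  moreover have "deriv \<phi> 0 = deriv f 0 / (4 * (w - f 0))"
  proof -
    have dh: "(h has_field_derivative deriv h 0) (at 0)"
      using holh by (intro holomorphic_derivI) auto
    have df: "(f has_field_derivative deriv f 0) (at 0)"
      using hol by (intro holomorphic_derivI) auto
    have "(g has_field_derivative - deriv f 0 / (w - f 0)) (at 0)"
      unfolding g_def using w0 by (auto intro!: derivative_eq_intros df)
    moreover have "((\<lambda>z. (h z)\<^sup>2) has_field_derivative 2 * deriv h 0) (at 0)"
      by (auto intro!: derivative_eq_intros dh simp: h0)
    then have "(g has_field_derivative 2 * deriv h 0) (at 0)"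
      by (rule has_field_derivative_transform_within_open[where S = "ball 0 1"]) (auto simp: hg)
    ultimately have h': "2 * deriv h 0 = - deriv f 0 / (w - f 0)"
      using DERIV_unique by blast
    have "(\<phi> has_field_derivative - deriv h 0 / 2) (at 0)"
      unfolding \<phi>_def by (auto intro!: derivative_eq_intros dh simp: h0)
    then have "deriv \<phi> 0 = - deriv h 0 / 2" by (rule DERIV_imp_deriv)
    also have "\<dots> = - (2 * deriv h 0) / 4" by simp
    also have "\<dots> = deriv f 0 / (4 * (w - f 0))" unfolding h' by simp
    finally show ?thesis .
  qed
  ultimately have "cmod (deriv f 0) / (4 * cmod (w - f 0)) \<le> 1"
    by (simp only: norm_divide norm_mult norm_numeral)
  then have "cmod (deriv f 0) \<le> 4 * cmod (w - f 0)"
    using w0 by (simp add: divide_le_eq)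
  with w show False by (simp add: dist_norm norm_minus_commute)
qed

section \<open>Reduction to the idempotent components\<close>

lemma idem_comb_eq_idem_comb_iff [simp]:
  "idem_comb a b = idem_comb c d \<longleftrightarrow> a = c \<and> b = d"
  by (metis idem_comb_eq_iff)

lemma idem_comb_in_prod_set_iff [simp]:
  "idem_comb a b \<in> prod_set A B \<longleftrightarrow> a \<in> A \<and> b \<in> B"
  by (auto simp: prod_set_def)

lemma bc_idem_comb: "bc1 (idem_comb a b) = (a + b) / 2" "bc2 (idem_comb a b) = \<i> * (a - b) / 2"
  by (simp_all add: idem_comb_def of_complex_def e1_def e2_def bc_k_def bc_i_def bc_j_def
      field_simps)

lemma idem_comb_diff: "idem_comb a b - idem_comb c d = idem_comb (a - c) (b - d)"
  by (simp add: bicomplex_eq_iff bc_idem_comb field_simps)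

lemma idem_comb_mult: "idem_comb a b * idem_comb c d = idem_comb (a * c) (b * d)"
  by (simp add: bicomplex_eq_iff bc_idem_comb field_simps)

lemma idem_comb_same: "idem_comb t t = of_complex t"
  by (simp add: bicomplex_eq_iff bc_idem_comb of_complex_def)

lemma idem_comb_divide:
  assumes "c \<noteq> 0" "d \<noteq> 0"
  shows "idem_comb a b / idem_comb c d = idem_comb (a / c) (b / d)"
proof -
  have "idem_comb a b = idem_comb (a / c) (b / d) * idem_comb c d"
    using assms by (simp add: idem_comb_mult)
  moreover have "idem_comb c d * inverse (idem_comb c d) = 1"
    using assms by (simp add: bicomplex_right_inverse idem_comb_in_zero_divisors0_iff)
  ultimately show ?thesis
    by (simp add: divide_bicomplex_def mult.assoc)
qed

definition idem1 :: "bicomplex \<Rightarrow> complex" where "idem1 Z = bc1 Z - \<i> * bc2 Z"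
definition idem2 :: "bicomplex \<Rightarrow> complex" where "idem2 Z = bc1 Z + \<i> * bc2 Z"

lemma idem_components [simp]: "idem1 (idem_comb a b) = a" "idem2 (idem_comb a b) = b"
  using idem_comb_eq_iff[of "idem_comb a b" a b] by (simp_all add: idem1_def idem2_def)

lemma bounded_linear_bc: "bounded_linear bc1" "bounded_linear bc2"
proof -
  have "cmod (bc1 Z) \<le> norm Z * 1" "cmod (bc2 Z) \<le> norm Z * 1" for Z
    by (simp_all add: norm_bicomplex_def real_le_rsqrt)
  then show "bounded_linear bc1" "bounded_linear bc2"
    by (auto intro!: bounded_linear_intro[where K = 1] simp: scaleR_bicomplex_def)
qed

lemma bounded_linear_idem: "bounded_linear idem1" "bounded_linear idem2"
  unfolding idem1_def idem2_def
  by (intro bounded_linear_sub bounded_linear_add bounded_linear_bc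
      bounded_linear_compose[OF bounded_linear_mult_right])+

text \<open>The bicomplex limit is taken along \<open>t \<mapsto> Z0 + t\<close> with \<open>t\<close> complex: this path moves both idempotent
  coordinates by \<open>t\<close>, avoids the zero divisors, and along it the bicomplex difference quotient is the
  pair of the two complex ones.\<close>

lemma has_bc_derivative_components:
  assumes der: "has_bc_derivative F L (idem_comb b1 b2) (prod_set D1 D2)"
    and D: "open D1" "open D2" "b1 \<in> D1" "b2 \<in> D2"
    and F: "\<And>z w. z \<in> D1 \<Longrightarrow> w \<in> D2 \<Longrightarrow> F (idem_comb z w) = idem_comb (F1 z) (F2 w)"
  shows "(F1 has_field_derivative idem1 L) (at b1)" "(F2 has_field_derivative idem2 L) (at b2)"
proof -
  let ?P = "idem_comb b1 b2"
  let ?Q = "\<lambda>t. idem_comb (b1 + t) (b2 + t)"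
  let ?S = "{Z \<in> prod_set D1 D2. Z - ?P \<notin> zero_divisors0}"
  let ?q1 = "\<lambda>t. (F1 (b1 + t) - F1 b1) / t" and ?q2 = "\<lambda>t. (F2 (b2 + t) - F2 b2) / t"
  have ev: "\<forall>\<^sub>F t in at 0. b + t \<in> D" if "open D" "b \<in> D" for b :: complex and D
  proof -
    have "((\<lambda>t. b + t) \<longlongrightarrow> b + 0) (at 0)" by (intro tendsto_intros)
    then show ?thesis using that by (intro topological_tendstoD) auto
  qed
  have near: "\<forall>\<^sub>F t in at 0. t \<noteq> 0 \<and> b1 + t \<in> D1 \<and> b2 + t \<in> D2"
    using ev D by (intro eventually_conj eventually_neq_at_within) auto
  have "(?Q \<longlongrightarrow> ?P) (at 0)"
  proof (rule LIM_zero_cancel, rule tendsto_norm_zero_cancel)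
    have "norm (?Q t - ?P) = cmod t" for t
      by (simp add: idem_comb_diff idem_comb_same of_complex_def norm_bicomplex_def)
    then show "((\<lambda>t. norm (?Q t - ?P)) \<longlongrightarrow> 0) (at 0)"
      by (simp add: tendsto_norm_zero)
  qed
  moreover have "\<forall>\<^sub>F t in at 0. ?Q t \<in> ?S \<and> ?Q t \<noteq> ?P"
    using near by eventually_elim (simp add: idem_comb_diff idem_comb_in_zero_divisors0_iff)
  ultimately have "filterlim ?Q (at ?P within ?S) (at 0)"
    by (simp add: filterlim_at)
  then have "((\<lambda>t. (F (?Q t) - F ?P) / (?Q t - ?P)) \<longlongrightarrow> L) (at 0)"
    using der unfolding has_bc_derivative_def by (rule filterlim_compose[rotated])
  moreover have "\<forall>\<^sub>F t in at 0. (F (?Q t) - F ?P) / (?Q t - ?P) = idem_comb (?q1 t) (?q2 t)"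
    using near by eventually_elim (simp add: F D idem_comb_diff idem_comb_divide)
  ultimately have lim: "((\<lambda>t. idem_comb (?q1 t) (?q2 t)) \<longlongrightarrow> L) (at 0)"
    by (simp add: tendsto_cong)
  show "(F1 has_field_derivative idem1 L) (at b1)" "(F2 has_field_derivative idem2 L) (at b2)"
    using bounded_linear.tendsto[OF bounded_linear_idem(1) lim]
      bounded_linear.tendsto[OF bounded_linear_idem(2) lim]
    by (simp_all add: DERIV_def)
qed

lemma bc_disk_eq: "bc_disk r = prod_set (ball 0 r) (ball 0 r)"
  by (simp add: bc_disk_def prod_set_def)

lemma prod_set_eq_imp_factors_eq:
  assumes "prod_set A B = prod_set A' B'" "A \<noteq> {}" "B \<noteq> {}"
  shows "A = A'" "B = B'"
proof -
  have iff: "a \<in> A \<and> b \<in> B \<longleftrightarrow> a \<in> A' \<and> b \<in> B'" for a b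
    using assms(1) by (metis idem_comb_in_prod_set_iff)
  show "A = A'" "B = B'" using iff assms(2,3) by blast+
qed

theorem theorem2p7:
  fixes F :: "bicomplex \<Rightarrow> bicomplex"
  assumes "bc_holomorphic_on F (bc_disk 1)"
    and "bc_univalent_on F (bc_disk 1)"
    and "F 0 = 0"
    and "has_bc_derivative F 1 0 (bc_disk 1)"
  shows "bc_disk (1/4) \<subseteq> F ` bc_disk 1"
proof -
  define D where "D = ball (0::complex) 1"
  have D: "open D" "0 \<in> D" by (simp_all add: D_def)
  have disk: "bc_disk 1 = prod_set D D" by (simp add: bc_disk_eq D_def)
  obtain D1 D2 F1 F2 where D12: "prod_set D D = prod_set D1 D2"
    and F12: "\<forall>z\<in>D1. \<forall>w\<in>D2. F (idem_comb z w) = idem_comb (F1 z) (F2 w)"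
  proof -
    have "product_type_on F (prod_set D D)"
      using assms(2) by (simp add: bc_univalent_on_def disk)
    from this[unfolded product_type_on_def] show ?thesis
      by (elim exE conjE) (rule that)
  qed
  have "D1 = D" "D2 = D" using prod_set_eq_imp_factors_eq[OF D12] D by auto
  with F12 have F: "F (idem_comb z w) = idem_comb (F1 z) (F2 w)" if "z \<in> D" "w \<in> D" for z w
    using that by blast
  have zero: "(0::bicomplex) = idem_comb 0 0" and one: "(1::bicomplex) = idem_comb 1 1"
    by (simp_all add: idem_comb_eq_iff)
  have F0: "F1 0 = 0" "F2 0 = 0"
    using assms(3) F[of 0 0] D by (simp_all add: zero)
  have deriv0: "deriv F1 0 = 1" "deriv F2 0 = 1"
    using has_bc_derivative_components[of F 1 0 0 D D F1 F2] assms(4) D F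
    by (auto simp: disk zero one intro!: DERIV_imp_deriv)
  have hol: "F1 holomorphic_on D" "F2 holomorphic_on D"
  proof -
    have "\<exists>L. has_bc_derivative F L (idem_comb z z) (prod_set D D)" if "z \<in> D" for z
      using assms(1) that unfolding bc_holomorphic_on_def disk by simp
    then have "\<exists>d. (F1 has_field_derivative d) (at z)" "\<exists>d. (F2 has_field_derivative d) (at z)"
      if "z \<in> D" for z
      using has_bc_derivative_components[of F _ z z D D F1 F2] D F that by blast+
    then show "F1 holomorphic_on D" "F2 holomorphic_on D"
      using D by (simp_all add: holomorphic_on_open)
  qed
  have inj: "z = z' \<and> w = w'"
    if "z \<in> D" "z' \<in> D" "w \<in> D" "w' \<in> D" "F1 z = F1 z'" "F2 w = F2 w'" for z z' w w'
  proof -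
    have "F (idem_comb z w) = F (idem_comb z' w')" using that F by simp
    then have "idem_comb z w = idem_comb z' w'"
      using assms(2) that unfolding bc_univalent_on_def disk by (metis idem_comb_in_prod_set_iff)
    then show ?thesis by simp
  qed
  have inj12: "inj_on F1 D" "inj_on F2 D"
    using inj D by (auto intro!: inj_onI)
  have sub: "ball 0 (1/4) \<subseteq> F1 ` D" "ball 0 (1/4) \<subseteq> F2 ` D"
    using koebe_quarter[of F1] koebe_quarter[of F2] hol inj12 F0 deriv0 by (simp_all add: D_def)
  show ?thesis
    unfolding disk bc_disk_eq[of "1/4"]
  proof (rule subsetI)
    fix Z assume "Z \<in> prod_set (ball 0 (1/4)) (ball 0 (1/4))"
    then obtain a b where "Z = idem_comb a b" "a \<in> ball 0 (1/4)" "b \<in> ball 0 (1/4)"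
      unfolding prod_set_def by blast
    with sub obtain z w where "z \<in> D" "w \<in> D" "Z = idem_comb (F1 z) (F2 w)" by blast
    then show "Z \<in> F ` prod_set D D" by (metis F idem_comb_in_prod_set_iff image_eqI)
  qed
qed

end
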